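(* For every $\epsilon>0$ and every $L>\epsilon$ there exist a problem (that is, dimensions $n,m\ge 1$, functions $h:\mathbb{R}^n\to\mathbb{R}$ and $g:\mathbb{R}^n\to\mathbb{R}^m$, a set $X\subset\mathbb{R}^n$, and constants $\delta>0$, $\beta>0$) satisfying Assumptions 1-4 stated in the context, and dual vectors $\mu^1,\mu^2\in M$, such that, with $$\hat{x}_1:=\arg\min_{x\in X}L_\delta(x,\mu^1),\qquad \hat{x}_2:=\arg\min_{x\in X}L_\delta(x,\mu^2),$$ one has $\|\mu^1-\mu^2\|<\epsilon$ and $\|\hat{x}_1-\hat{x}_2\|>L$.
   Context: The problem is: minimize $h(x)$ subject to $g(x)\le 0$ (componentwise) and $x\in X$. The norm $\|\cdot\|$ is Euclidean. The regularized Lagrangian is $L_\delta(x,\mu)=h(x)+\mu^Tg(x)-\frac{\delta}{2}\|\mu\|^2$ with $\delta>0$. Assumption 1: $h$ is twice continuously differentiable and convex. Assumption 2: there is $\bar{x}\in X$ with $g(\bar{x})<0$ componentwise (a Slater point), and each $g_j$, $j=1,\dots,m$, is twice continuously differentiable and convex. Assumption 3: $X$ is non-empty, compact and convex, and decomposes as a product $X=X_1\times\cdots\times X_N$. Assumption 4 ($\beta$-diagonal dominance, $\beta>0$): the Hessian $H(x,\mu)=\nabla_x^2L_\delta(x,\mu)$ satisfies $|H_{ii}(x,\mu)|-\beta\ge\sum_{j\ne i}|H_{ij}(x,\mu)|$ for all $i\in\{1,\dots,n\}$, for all $x\in X$ and $\mu\in\mathbb{R}^m_+$. With $\bar{x}$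 a Slater point of $g$ and $h^*:=\min_{x\in X}h(x)$, the dual set is $$M:=\Big\{\mu\in\mathbb{R}^m_+:\|\mu\|_1\le\frac{h(\bar{x})-h^*}{\min_{1\le j\le m}-g_j(\bar{x})}\Big\}.$$ *)

theory Defs
  imports "HOL-Analysis.Analysis" "HOL-Analysis.Finite_Function_Topology"
begin

text \<open>
  The dimensions are existentially quantified inside the statement, so they cannot be types.
  The space of real \<open>n\<close>-vectors is the subspace \<open>Rn n\<close> of the finitely supported sequences,
  with coordinates \<open>0, \<dots>, n - 1\<close>. \<open>Rn n\<close> carries its usual vector space structure
  and topology. The \<open>norm\<close> of the library on this type, however, is the 1-norm; the
  Euclidean norm is \<open>enorm\<close>.
\<close>

type_synonym rvec = "nat \<Rightarrow>\<^sub>0 real"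

abbreviation coord :: "rvec \<Rightarrow> nat \<Rightarrow> real" where
  "coord \<equiv> Poly_Mapping.lookup"

definition Rn :: "nat \<Rightarrow> rvec set" where
  "Rn n = {x. Poly_Mapping.keys x \<subseteq> {..<n}}"

definition Rn_nonneg :: "nat \<Rightarrow> rvec set" where
  "Rn_nonneg n = {x \<in> Rn n. \<forall>i<n. 0 \<le> coord x i}"

definition enorm :: "rvec \<Rightarrow> real" where
  "enorm x = L2_set (coord x) (Poly_Mapping.keys x)"

abbreviation along :: "nat \<Rightarrow> (rvec \<Rightarrow> real) \<Rightarrow> rvec \<Rightarrow> real \<Rightarrow> real" where
  "along i f x \<equiv> \<lambda>t. f (x + Poly_Mapping.single i t)"

definition partial :: "nat \<Rightarrow> (rvec \<Rightarrow> real) \<Rightarrow> rvec \<Rightarrow> real" where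
  "partial i f x = deriv (along i f x) 0"

text \<open>\<open>k\<close> times continuously differentiable on \<open>Rn n\<close>: all partial derivatives up to
  order \<open>k\<close> exist and are continuous.\<close>

primrec Ck :: "nat \<Rightarrow> nat \<Rightarrow> (rvec \<Rightarrow> real) \<Rightarrow> bool" where
  "Ck 0 n f \<longleftrightarrow> continuous_on (Rn n) f"
| "Ck (Suc k) n f \<longleftrightarrow> continuous_on (Rn n) f \<and>
     (\<forall>i<n. (\<forall>x\<in>Rn n. along i f x differentiable (at 0)) \<and> Ck k n (partial i f))"

definition hessian :: "(rvec \<Rightarrow> real) \<Rightarrow> rvec \<Rightarrow> nat \<Rightarrow> nat \<Rightarrow> real" where
  "hessian f x i j = partial i (partial j f) x"

definition C2_convex :: "nat \<Rightarrow> (rvec \<Rightarrow> real) \<Rightarrow> bool" where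
  "C2_convex n f \<longleftrightarrow> Ck 2 n f \<and> convex_on (Rn n) f"

definition slater_point :: "nat \<Rightarrow> (rvec \<Rightarrow> rvec) \<Rightarrow> rvec set \<Rightarrow> rvec \<Rightarrow> bool" where
  "slater_point m g X x \<longleftrightarrow> x \<in> X \<and> (\<forall>j<m. coord (g x) j < 0)"

text \<open>\<open>X = X\<^sub>0 \<times> \<dots> \<times> X\<^bsub>N-1\<^esub>\<close> with \<open>X\<^sub>k\<close> a subset of \<open>Rn (d k)\<close> and
  \<open>n = d 0 + \<dots> + d (N - 1)\<close>: the \<open>k\<close>-th block of \<open>x\<close> consists of the \<open>d k\<close> consecutive
  coordinates of \<open>x\<close> that start at \<open>d 0 + \<dots> + d (k - 1)\<close>.\<close>

definition product_of ::
    "nat \<Rightarrow> rvec set \<Rightarrow> nat \<Rightarrow> (nat \<Rightarrow> nat) \<Rightarrow> (nat \<Rightarrow> rvec set) \<Rightarrow> bool" where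
  "product_of n X N d Xs \<longleftrightarrow>
     (\<forall>k<N. 1 \<le> d k \<and> Xs k \<subseteq> Rn (d k)) \<and> (\<Sum>k<N. d k) = n \<and>
     X = {x \<in> Rn n. \<forall>k<N. \<exists>y\<in>Xs k. \<forall>i<d k. coord x ((\<Sum>l<k. d l) + i) = coord y i}"

definition admissible_set :: "nat \<Rightarrow> rvec set \<Rightarrow> bool" where
  "admissible_set n X \<longleftrightarrow> X \<subseteq> Rn n \<and> X \<noteq> {} \<and> compact X \<and> convex X \<and>
     (\<exists>N\<ge>1. \<exists>d Xs. product_of n X N d Xs)"

definition reg_lagrangian ::
    "nat \<Rightarrow> (rvec \<Rightarrow> real) \<Rightarrow> (rvec \<Rightarrow> rvec) \<Rightarrow> real \<Rightarrow> rvec \<Rightarrow> rvec \<Rightarrow> real" where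
  "reg_lagrangian m h g \<delta> x \<mu> =
     h x + (\<Sum>j<m. coord \<mu> j * coord (g x) j) - \<delta> / 2 * (enorm \<mu>)\<^sup>2"

definition diag_dominant ::
    "nat \<Rightarrow> nat \<Rightarrow> (rvec \<Rightarrow> real) \<Rightarrow> (rvec \<Rightarrow> rvec) \<Rightarrow> rvec set \<Rightarrow> real \<Rightarrow> real \<Rightarrow> bool" where
  "diag_dominant n m h g X \<delta> \<beta> \<longleftrightarrow>
     (\<forall>x\<in>X. \<forall>\<mu>\<in>Rn_nonneg m. \<forall>i<n.
        let H = hessian (\<lambda>y. reg_lagrangian m h g \<delta> y \<mu>) x
        in \<bar>H i i\<bar> - \<beta> \<ge> (\<Sum>j\<in>{..<n} - {i}. \<bar>H i j\<bar>))"

definition dual_set ::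
    "nat \<Rightarrow> (rvec \<Rightarrow> real) \<Rightarrow> (rvec \<Rightarrow> rvec) \<Rightarrow> rvec set \<Rightarrow> rvec \<Rightarrow> rvec set" where
  "dual_set m h g X xbar =
     {\<mu> \<in> Rn_nonneg m.
        (\<Sum>j<m. \<bar>coord \<mu> j\<bar>) \<le>
        (h xbar - (LEAST v. v \<in> h ` X)) / Min ((\<lambda>j. - coord (g xbar) j) ` {..<m})}"

definition argmin_set :: "(rvec \<Rightarrow> real) \<Rightarrow> rvec set \<Rightarrow> rvec set" where
  "argmin_set f X = {x. is_arg_min f (\<lambda>y. y \<in> X) x}"

end

theory Submission
  imports Defs
begin

text \<open>
  The Lagrangian minimizer depends on the dual vector with a rate proportional to the slope of the
  constraint, which nothing in Assumptions 1-4 bounds. In dimension one take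
  \<open>h x = x\<^sup>2 / 2\<close>, \<open>g x = c (x + L)\<close> and \<open>X = [- 2 L, 2 L]\<close>: the
  minimizer at \<open>\<mu>\<close> is \<open>- c \<mu>\<close>, and with \<open>c = 4 L / \<epsilon>\<close> it moves from
  \<open>0\<close> to \<open>- 2 L\<close> as \<open>\<mu>\<close> moves from \<open>0\<close> to \<open>\<epsilon> / 2\<close>. The offset of \<open>g\<close> is chosen
  so that the Slater point \<open>- 2 L\<close> gives \<open>M = [0, \<epsilon> / 2]\<close>.
\<close>

lemma lookup_scaleR [simp]:
  "Poly_Mapping.lookup (r *\<^sub>R x) i = r *\<^sub>R Poly_Mapping.lookup x i"
proof -
  have "finite {i. r *\<^sub>R Poly_Mapping.lookup x i \<noteq> 0}"
    by (rule finite_subset[of _ "Poly_Mapping.keys x"]) (auto simp: in_keys_iff)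
  then show ?thesis
    by (simp add: scaleR_poly_mapping_def)
qed

text \<open>The library norm sums the absolute values of all coordinates, so a single one is a
  summand. This is what makes coordinates continuous.\<close>

lemma norm_lookup_le:
  "norm (Poly_Mapping.lookup x i) \<le> norm x"
proof (cases "i \<in> Poly_Mapping.keys x")
  case True
  then show ?thesis
    by (auto simp: norm_poly_mapping_def dist_poly_mapping_def intro: member_le_sum)
qed (simp add: in_keys_iff)

lemma bounded_linear_lookup:
  "bounded_linear (\<lambda>x. Poly_Mapping.lookup x i)"
  by (rule bounded_linear_intro[where K = 1]) (auto simp: lookup_add norm_lookup_le)

lemma continuous_on_lookup [continuous_intros]:
  "continuous_on S f \<Longrightarrow> continuous_on S (\<lambda>x. Poly_Mapping.lookup (f x) i)"
  by (rule bounded_linear.continuous_on[OF bounded_linear_lookup])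

lemma bounded_linear_single:
  "bounded_linear (\<lambda>t. Poly_Mapping.single i t)"
proof (rule bounded_linear_intro[where K = 1])
  show "Poly_Mapping.single i (r *\<^sub>R t) = r *\<^sub>R Poly_Mapping.single i t" for r t
    by (rule poly_mapping_eqI) (simp add: lookup_single when_def)
qed (auto simp: single_add norm_poly_mapping_def dist_poly_mapping_def)

lemma single_mem_Rn [simp]: "i < n \<Longrightarrow> Poly_Mapping.single i t \<in> Rn n"
  by (simp add: Rn_def)

text \<open>Lets coordinate 0 decide equality of points, both for the product decomposition and for
  uniqueness of minimizers.\<close>

lemma Rn_1_eq_range: "Rn 1 = range (Poly_Mapping.single 0)"
proof
  show "Rn 1 \<subseteq> range (Poly_Mapping.single 0)"
  proof
    fix x :: rvec
    assume "x \<in> Rn 1"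
    then have "x = Poly_Mapping.single 0 (coord x 0)"
      by (intro poly_mapping_eqI) (auto simp: Rn_def lookup_single when_def in_keys_iff)
    then show "x \<in> range (Poly_Mapping.single 0)"
      by (rule range_eqI)
  qed
qed auto

lemma convex_Rn: "convex (Rn n)"
  unfolding convex_def Rn_def
  by (auto simp: subset_iff in_keys_iff lookup_add) (metis add.right_neutral mult_zero_right)

lemma enorm_single [simp]: "enorm (Poly_Mapping.single i t) = \<bar>t\<bar>"
  by (simp add: enorm_def L2_set_def)

lemma admissible_set_1:
  assumes "X \<subseteq> Rn 1" "X \<noteq> {}" "compact X" "convex X"
  shows "admissible_set 1 X"
proof -
  \<comment> \<open>The trivial decomposition: a single block of size 1, namely \<open>X\<close>
    itself.\<close>
  have "product_of 1 X 1 (\<lambda>_. 1) (\<lambda>_. X)"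
    using assms(1) unfolding Rn_1_eq_range
    by (force simp: product_of_def Rn_1_eq_range[simplified])
  with assms show ?thesis
    unfolding admissible_set_def by blast
qed

text \<open>One family covers the objective, the affine constraint (\<open>a = 0\<close>) and every
  Lagrangian. It is closed under \<open>partial 0\<close>, so smoothness of any order follows by
  induction over all coefficients at once.\<close>

definition quadratic :: "real \<Rightarrow> real \<Rightarrow> real \<Rightarrow> rvec \<Rightarrow> real" where
  "quadratic a b c x = a * (coord x 0)\<^sup>2 + b * coord x 0 + c"

lemma along_quadratic_has_derivative:
  "(along 0 (quadratic a b c) x has_real_derivative quadratic 0 (2 * a) b x) (at 0)"
  unfolding quadratic_def lookup_add
  by (auto intro!: derivative_eq_intros simp: algebra_simps)

lemma partial_quadratic: "partial 0 (quadratic a b c) = quadratic 0 (2 * a) b"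
  unfolding partial_def by (rule ext) (rule DERIV_imp_deriv[OF along_quadratic_has_derivative])

lemma hessian_quadratic: "hessian (quadratic a b c) x 0 0 = 2 * a"
  by (simp add: hessian_def partial_quadratic) (simp add: quadratic_def)

lemma Ck_quadratic: "Ck k 1 (quadratic a b c)"
proof (induction k arbitrary: a b c)
  case 0
  show ?case
    unfolding Ck.simps quadratic_def by (intro continuous_intros)
next
  case (Suc k)
  have "continuous_on (Rn 1) (quadratic a b c)"
    unfolding quadratic_def by (intro continuous_intros)
  moreover have "along 0 (quadratic a b c) x differentiable (at 0)" for x
    using along_quadratic_has_derivative real_differentiable_def by blast
  ultimately show ?case
    using Suc by (simp add: partial_quadratic)
qed

lemma convex_on_quadratic:
  assumes "a \<ge> 0"
  shows "convex_on (Rn n) (quadratic a b c)"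
  unfolding convex_on_def
proof (intro conjI ballI allI impI)
  fix x y :: rvec and u v :: real
  assume uv: "0 \<le> u" "0 \<le> v" "u + v = 1"
  define s t where "s = coord x 0" and "t = coord y 0"
  have v: "v = 1 - u"
    using uv by simp
  have "u * quadratic a b c x + v * quadratic a b c y - quadratic a b c (u *\<^sub>R x + v *\<^sub>R y)
      = a * (u * v * (s - t)\<^sup>2)"
    unfolding quadratic_def lookup_add lookup_scaleR s_def t_def v
    by (simp add: power2_eq_square algebra_simps)
  also have "\<dots> \<ge> 0"
    using assms uv by simp
  finally show "quadratic a b c (u *\<^sub>R x + v *\<^sub>R y) \<le> u * quadratic a b c x + v * quadratic a b c y"
    by simp
qed (rule convex_Rn)

lemma C2_convex_quadratic: "a \<ge> 0 \<Longrightarrow> C2_convex 1 (quadratic a b c)"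
  unfolding C2_convex_def by (intro conjI Ck_quadratic convex_on_quadratic)

text \<open>The hypothesis on \<open>x\<close> says that it is the vertex of the parabola.
  Completing the square there leaves \<open>a\<close> times a squared distance, which vanishes only
  at \<open>x\<close>.\<close>

lemma argmin_set_quadratic:
  assumes "a > 0" "X \<subseteq> Rn 1" "x \<in> X" "2 * a * coord x 0 + b = 0"
  shows "argmin_set (quadratic a b c) X = {x}"
proof -
  have diff: "quadratic a b c y - quadratic a b c x = a * (coord y 0 - coord x 0)\<^sup>2" for y
  proof -
    have "b = - 2 * a * coord x 0"
      using assms(4) by simp
    then show ?thesis
      unfolding quadratic_def by (simp add: power2_eq_square algebra_simps)
  qed
  have min: "quadratic a b c x \<le> quadratic a b c y" for y
    using diff[of y] assms(1) by (smt (verit) mult_nonneg_nonneg zero_le_power2)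
  have unique: "y = x" if "y \<in> X" "quadratic a b c y \<le> quadratic a b c x" for y
  proof -
    have "coord y 0 = coord x 0"
      using diff[of y] min[of y] that assms(1) by simp
    moreover have "x \<in> Rn 1" "y \<in> Rn 1"
      using that(1) assms(2,3) by auto
    ultimately show ?thesis
      unfolding Rn_1_eq_range by auto
  qed
  show ?thesis
    unfolding argmin_set_def is_arg_min_linorder using min unique assms(3) by blast
qed

theorem theorem1:
  fixes \<epsilon> L :: real
  assumes "\<epsilon> > 0" and "L > \<epsilon>"
  shows "\<exists>(n::nat) (m::nat) (h :: rvec \<Rightarrow> real) (g :: rvec \<Rightarrow> rvec) (X :: rvec set)
            (\<delta>::real) (\<beta>::real) (xbar :: rvec).
           n \<ge> 1 \<and> m \<ge> 1 \<and> \<delta> > 0 \<and> \<beta> > 0 \<and>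
           C2_convex n h \<and>
           g \<in> Rn n \<rightarrow> Rn m \<and> slater_point m g X xbar \<and>
           (\<forall>j<m. C2_convex n (\<lambda>x. coord (g x) j)) \<and>
           admissible_set n X \<and>
           diag_dominant n m h g X \<delta> \<beta> \<and>
           (\<exists>\<mu>1\<in>dual_set m h g X xbar. \<exists>\<mu>2\<in>dual_set m h g X xbar. \<exists>x1 x2.
              argmin_set (\<lambda>x. reg_lagrangian m h g \<delta> x \<mu>1) X = {x1} \<and>
              argmin_set (\<lambda>x. reg_lagrangian m h g \<delta> x \<mu>2) X = {x2} \<and>
              enorm (\<mu>1 - \<mu>2) < \<epsilon> \<and> enorm (x1 - x2) > L)"
proof -
  let ?s = "Poly_Mapping.single (0::nat) :: real \<Rightarrow> rvec"
  have L: "L > 0"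
    using assms by simp
  define c where "c = 4 * L / \<epsilon>"
  \<comment> \<open>The second fact is the distance the minimizer travels; the third is the dual
    bound, the gap in \<open>h\<close> divided by the slack at \<open>xbar\<close>.\<close>
  have c: "c > 0" "c * (\<epsilon> / 2) = 2 * L" "2 * L\<^sup>2 / (c * L) = \<epsilon> / 2"
    using assms L by (simp_all add: c_def power2_eq_square field_simps)
  define h where "h = quadratic (1/2) 0 0"
  define g where "g x = ?s (quadratic 0 c (c * L) x)" for x
  define X where "X = ?s ` {- 2 * L..2 * L}"
  define xbar where "xbar = ?s (- 2 * L)"
  have X_Rn: "X \<subseteq> Rn 1"
    by (auto simp: X_def)
  have mem_X: "?s t \<in> X" if "\<bar>t\<bar> \<le> 2 * L" for t
    using that unfolding X_def by (intro imageI) (simp add: abs_le_iff)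
  \<comment> \<open>As the constraint is affine and the regularization is constant in
    \<open>x\<close>, \<open>\<mu>\<close> never enters the leading coefficient. The Hessian is
    therefore 1 throughout, which permits \<beta> = 1.\<close>
  have lagrangian: "(\<lambda>x. reg_lagrangian 1 h g 1 x \<mu>)
      = quadratic (1/2) (coord \<mu> 0 * c) (coord \<mu> 0 * (c * L) - (enorm \<mu>)\<^sup>2 / 2)" for \<mu>
    by (rule ext) (simp add: reg_lagrangian_def h_def g_def quadratic_def algebra_simps)
  have g_xbar: "coord (g xbar) 0 = - (c * L)"
    by (simp add: g_def xbar_def quadratic_def)
  have h_xbar: "h xbar = 2 * L\<^sup>2"
    by (simp add: h_def xbar_def quadratic_def power2_eq_square)
  have h_Least: "(LEAST v. v \<in> h ` X) = 0"
  proof (rule Least_equality)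
    show "0 \<in> h ` X"
      using L mem_X[of 0] by (force simp: h_def quadratic_def)
  qed (auto simp: h_def quadratic_def)
  have dual: "?s t \<in> dual_set 1 h g X xbar" if "0 \<le> t" "t \<le> \<epsilon> / 2" for t
  proof -
    have bound: "(h xbar - 0) / Min ((\<lambda>j. - coord (g xbar) j) ` {..<1}) = \<epsilon> / 2"
      by (simp add: h_xbar g_xbar lessThan_Suc c(3))
    show ?thesis
      unfolding dual_set_def Rn_nonneg_def h_Least bound using that by simp
  qed
  have slater: "slater_point 1 g X xbar"
    using mem_X[of "- 2 * L"] L c(1) g_xbar by (simp add: slater_point_def xbar_def)
  have admissible: "admissible_set 1 X"
  proof (rule admissible_set_1[OF X_Rn])
    show "X \<noteq> {}"
      using mem_X[of 0] L by auto
    show "compact X"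
      unfolding X_def
      by (intro compact_continuous_image linear_continuous_on bounded_linear_single compact_Icc)
    show "convex X"
      unfolding X_def
      by (intro convex_linear_image bounded_linear.linear[OF bounded_linear_single]) simp
  qed
  have dominant: "diag_dominant 1 1 h g X 1 1"
    by (simp add: diag_dominant_def lagrangian[simplified] hessian_quadratic Let_def)
  have argmin: "argmin_set (\<lambda>x. reg_lagrangian 1 h g 1 x (?s t)) X = {?s (- (c * t))}"
    if "0 \<le> t" "t \<le> \<epsilon> / 2" for t
  proof -
    \<comment> \<open>The unconstrained vertex stays inside \<open>X\<close>, reaching its left
      endpoint exactly at \<open>t = \<epsilon> / 2\<close>.\<close>
    have "\<bar>- (c * t)\<bar> \<le> 2 * L"
      using that c(1) mult_left_mono[of t "\<epsilon> / 2" c] unfolding c(2) by simp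
    then show ?thesis
      unfolding lagrangian by (intro argmin_set_quadratic X_Rn mem_X) simp_all
  qed
  have "argmin_set (\<lambda>x. reg_lagrangian 1 h g 1 x (?s 0)) X = {?s 0}"
    and "argmin_set (\<lambda>x. reg_lagrangian 1 h g 1 x (?s (\<epsilon> / 2))) X = {?s (- 2 * L)}"
    using argmin[of 0] argmin[of "\<epsilon> / 2"] assms(1) c(2) by simp_all
  \<comment> \<open>The two distances are \<open>\<epsilon> / 2\<close> and \<open>2 * L\<close>;
    the factors of 2 make both inequalities strict.\<close>
  moreover have "enorm (?s 0 - ?s (\<epsilon> / 2)) < \<epsilon>" "enorm (?s 0 - ?s (- 2 * L)) > L"
    using assms(1) L by (simp_all only: single_diff[symmetric] enorm_single)
  moreover have "?s 0 \<in> dual_set 1 h g X xbar" "?s (\<epsilon> / 2) \<in> dual_set 1 h g X xbar"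
    using dual[of 0] dual[of "\<epsilon> / 2"] assms(1) by simp_all
  moreover have "C2_convex 1 h" "\<forall>j<1. C2_convex 1 (\<lambda>x. coord (g x) j)"
    using C2_convex_quadratic[of "1/2"] C2_convex_quadratic[of 0]
    by (simp_all add: h_def g_def)
  moreover have "g \<in> Rn 1 \<rightarrow> Rn 1"
    by (simp add: g_def)
  ultimately show ?thesis
    using slater admissible dominant
    by (intro exI[of _ "1::nat"] exI[of _ "1::real"] exI[of _ h] exI[of _ g] exI[of _ X]
        exI[of _ xbar] conjI bexI[of _ "?s 0"] bexI[of _ "?s (\<epsilon> / 2)"] exI[of _ "?s 0"]
        exI[of _ "?s (- 2 * L)"]) simp_all
qed

end
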